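(* Let $\mathcal{Y}\subseteq\mathcal{X}$ be a closed $\mathfrak{C}$-invariant subspace and let $\mathcal{V}_1,\dots,\mathcal{V}_k$ be $\mathfrak{C}$-decomposable subspaces of $\mathcal{X}$. Then $$\overline{\mathcal{Y}+\bigcap_{j=1}^k\mathcal{V}_j}=\bigcap_{j=1}^k\overline{\mathcal{Y}+\mathcal{V}_j}.$$ Moreover, if $\mathcal{Y}$ is $\mathfrak{C}$-reflexive then $\overline{\mathcal{Y}+\bigcap_{j=1}^k\mathcal{V}_j}$ is $\mathfrak{C}$-reflexive.
   Context: $\mathcal{X}$ is a dual Banach space with a fixed predual $\mathcal{X}_*$. Closures ($\overline{\,\cdot\,}$), "closed", convergence and cluster points in $\mathcal{X}$ are always with respect to the weak* topology. $\mathcal{B}(\mathcal{X})$ is the space of bounded linear operators on $\mathcal{X}$, with operator norm $\|\cdot\|$; $\phi\in\mathcal{B}(\mathcal{X})$ is an idempotent if $\phi^2=\phi$, and $\mathrm{Ran}\,\phi$ is its range. $\mathfrak{C}\subseteq\mathcal{B}(\mathcal{X})$ is a Boolean algebra of pairwise commuting weak* continuous idempotents: $0,\mathrm{id}\in\mathfrak{C}$; $\phi\in\mathfrak{C}$ implies $\phi^\perp:=\mathrm{id}-\phi\in\mathfrak{C}$; and $\phi\psi,\ \phi+\psi-\phi\psi\in\mathfrak{C}$ whenever $\phi,\psi\in\mathfrak{C}$. A linear subspace $\mathcal{Y}\subseteq\mathcal{X}$ is $\mathfrak{C}$-invariant if $\phi(\mathcal{Y})\subseteq\mathcal{Y}$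 for all $\phi\in\mathfrak{C}$; $\mathfrak{C}$-injective if $\mathcal{Y}=\mathrm{Ran}\,\phi$ for some $\phi\in\mathfrak{C}$. Its $\mathfrak{C}$-reflexive hull is $\mathrm{Ref}_{\mathfrak{C}}\mathcal{Y}=\{x\in\mathcal{X}:\text{ if }\phi\in\mathfrak{C}\text{ and }\phi(\mathcal{Y})=\{0\}\text{ then }\phi(x)=0\}$, and $\mathcal{Y}$ is $\mathfrak{C}$-reflexive if $\mathrm{Ref}_{\mathfrak{C}}\mathcal{Y}=\mathcal{Y}$. For a sequence $(\mathcal{M}_n)$ of closed subsets of $\mathcal{X}$, $\limsup_{n}\mathcal{M}_n$ is the set of all cluster points of sequences $(x_n)$ with $x_n\in\mathcal{M}_n$ for all $n$. A closed subspace $\mathcal{V}\subseteq\mathcal{X}$ is $\mathfrak{C}$-decomposable if there exist a sequence $(\phi_n)_{n=1}^\infty\subseteq\mathfrak{C}$ and a sequence $(\mathcal{W}_n)_{n=1}^\infty$ of $\mathfrak{C}$-injective subspaces such that (a) there is $C>0$ with $\|\phi_n\|\le C$ for all $n$; (b) $\mathcal{V}\subseteq\mathrm{Ran}\,\phi_n+\mathcal{W}_n$ for each $n$; (c) $\mathcal{W}_n\subseteq\mathcal{V}$ for each $n$; (d) $\limsup_{n}\mathrm{Ran}\,\phi_n\subseteq\mathcal{V}$. *)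

theory Defs
  imports "HOL-Analysis.Analysis" "HOL-Library.Set_Algebras"
begin

text \<open>
  The library's Banach spaces are real. A Banach space over a scalar field \<open>'k\<close> is a real Banach
  space with a compatible multiplication by scalars of \<open>'k\<close>. By the theorems of Ostrowski and
  Mazur, the fields of class \<open>{real_normed_field, heine_borel}\<close> are the real and the complex
  numbers up to isometric isomorphism, so that both kinds of scalars are covered.
\<close>

locale banach_space_over = vector_space smul
  for smul :: "'k::{real_normed_field, heine_borel} \<Rightarrow> 'x::banach \<Rightarrow> 'x" +
  assumes scale_of_real: "smul (of_real r) x = r *\<^sub>R x"
    and norm_scale: "norm (smul c x) = norm c * norm x"

text \<open>
  The pairing \<open>\<langle>x, p\<rangle>\<close> identifies \<open>'x\<close>, as a normed space over \<open>'k\<close>, with the space of all bounded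
  \<open>'k\<close>-linear functionals on the fixed predual \<open>'p\<close>.
\<close>

locale dual_banach_space =
  X: banach_space_over scaleX + P: banach_space_over scaleP
  for scaleX :: "'k::{real_normed_field, heine_borel} \<Rightarrow> 'x::banach \<Rightarrow> 'x"
    and scaleP :: "'k \<Rightarrow> 'p::banach \<Rightarrow> 'p" +
  fixes pairing :: "'x \<Rightarrow> 'p \<Rightarrow> 'k"
  assumes pairing_add_left: "pairing (x + y) p = pairing x p + pairing y p"
    and pairing_scale_left: "pairing (scaleX c x) p = c * pairing x p"
    and pairing_bounded_linear: "bounded_linear (pairing x)"
    and pairing_scale_right: "pairing x (scaleP c p) = c * pairing x p"
    and pairing_isometric: "onorm (pairing x) = norm x"
    and pairing_onto:
      "\<lbrakk>bounded_linear f; \<And>c p. f (scaleP c p) = c * f p\<rbrakk> \<Longrightarrow> \<exists>x. pairing x = f"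

text \<open>
  Here \<open>euclidean\<close> is the topology of pointwise convergence on \<open>'p \<Rightarrow> 'k\<close>. The library topology of
  the type \<open>'x\<close> is the norm topology.
\<close>

definition weak_star :: "('x \<Rightarrow> 'p \<Rightarrow> 'k::topological_space) \<Rightarrow> 'x topology" where
  "weak_star pairing = pullback_topology UNIV pairing euclidean"

text \<open>
  An element of the type \<open>'x \<Rightarrow>\<^sub>L 'x\<close> is only real linear, so linearity over \<open>'k\<close> is required
  separately. The operator norm does not depend on the scalars.
\<close>

definition bounded_operators ::
    "('k \<Rightarrow> 'x \<Rightarrow> 'x) \<Rightarrow> ('x::real_normed_vector \<Rightarrow>\<^sub>L 'x) set" where
  "bounded_operators smul = {\<phi>. \<forall>c x. blinfun_apply \<phi> (smul c x) = smul c (blinfun_apply \<phi> x)}"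

abbreviation Ran :: "('x::real_normed_vector \<Rightarrow>\<^sub>L 'x) \<Rightarrow> 'x set" where
  "Ran \<phi> \<equiv> range (blinfun_apply \<phi>)"

definition idempotent_boolean_algebra ::
    "('k \<Rightarrow> 'x \<Rightarrow> 'x) \<Rightarrow> 'x topology \<Rightarrow> ('x::real_normed_vector \<Rightarrow>\<^sub>L 'x) set \<Rightarrow> bool" where
  "idempotent_boolean_algebra smul T \<CC> \<longleftrightarrow>
     \<CC> \<subseteq> bounded_operators smul \<and>
     (\<forall>\<phi>\<in>\<CC>. \<phi> o\<^sub>L \<phi> = \<phi> \<and> continuous_map T T (blinfun_apply \<phi>)) \<and>
     (\<forall>\<phi>\<in>\<CC>. \<forall>\<psi>\<in>\<CC>. \<phi> o\<^sub>L \<psi> = \<psi> o\<^sub>L \<phi>) \<and>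
     0 \<in> \<CC> \<and> id_blinfun \<in> \<CC> \<and>
     (\<forall>\<phi>\<in>\<CC>. id_blinfun - \<phi> \<in> \<CC>) \<and>
     (\<forall>\<phi>\<in>\<CC>. \<forall>\<psi>\<in>\<CC>. \<phi> o\<^sub>L \<psi> \<in> \<CC> \<and> \<phi> + \<psi> - (\<phi> o\<^sub>L \<psi>) \<in> \<CC>)"

definition invariant_subspace ::
    "('k::field \<Rightarrow> 'x \<Rightarrow> 'x) \<Rightarrow> ('x::real_normed_vector \<Rightarrow>\<^sub>L 'x) set \<Rightarrow> 'x set \<Rightarrow> bool" where
  "invariant_subspace smul \<CC> Y \<longleftrightarrow>
     module.subspace smul Y \<and> (\<forall>\<phi>\<in>\<CC>. blinfun_apply \<phi> ` Y \<subseteq> Y)"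

definition injective_subspace ::
    "('k::field \<Rightarrow> 'x \<Rightarrow> 'x) \<Rightarrow> ('x::real_normed_vector \<Rightarrow>\<^sub>L 'x) set \<Rightarrow> 'x set \<Rightarrow> bool" where
  "injective_subspace smul \<CC> Y \<longleftrightarrow> module.subspace smul Y \<and> (\<exists>\<phi>\<in>\<CC>. Y = Ran \<phi>)"

definition reflexive_hull :: "('x::real_normed_vector \<Rightarrow>\<^sub>L 'x) set \<Rightarrow> 'x set \<Rightarrow> 'x set" where
  "reflexive_hull \<CC> Y = {x. \<forall>\<phi>\<in>\<CC>. blinfun_apply \<phi> ` Y = {0} \<longrightarrow> blinfun_apply \<phi> x = 0}"

definition reflexive_subspace ::
    "('k::field \<Rightarrow> 'x \<Rightarrow> 'x) \<Rightarrow> ('x::real_normed_vector \<Rightarrow>\<^sub>L 'x) set \<Rightarrow> 'x set \<Rightarrow> bool" where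
  "reflexive_subspace smul \<CC> Y \<longleftrightarrow> module.subspace smul Y \<and> reflexive_hull \<CC> Y = Y"

definition cluster_point :: "'x topology \<Rightarrow> (nat \<Rightarrow> 'x) \<Rightarrow> 'x \<Rightarrow> bool" where
  "cluster_point T u x \<longleftrightarrow>
     x \<in> topspace T \<and> (\<forall>U. openin T U \<and> x \<in> U \<longrightarrow> (\<exists>\<^sub>F n in sequentially. u n \<in> U))"

definition limsup_sets :: "'x topology \<Rightarrow> (nat \<Rightarrow> 'x set) \<Rightarrow> 'x set" where
  "limsup_sets T M = {x. \<exists>u. (\<forall>n. u n \<in> M n) \<and> cluster_point T u x}"

definition decomposable_subspace ::
    "('k::field \<Rightarrow> 'x \<Rightarrow> 'x) \<Rightarrow> 'x topology \<Rightarrow> ('x::real_normed_vector \<Rightarrow>\<^sub>L 'x) set \<Rightarrow> 'x set \<Rightarrow> bool"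
  where
  "decomposable_subspace smul T \<CC> V \<longleftrightarrow>
     module.subspace smul V \<and> closedin T V \<and>
     (\<exists>\<phi> W. (\<forall>n::nat. \<phi> n \<in> \<CC>) \<and> (\<forall>n. injective_subspace smul \<CC> (W n)) \<and>
        (\<exists>C>0. \<forall>n. norm (\<phi> n) \<le> C) \<and>
        (\<forall>n. V \<subseteq> Ran (\<phi> n) + W n) \<and>
        (\<forall>n. W n \<subseteq> V) \<and>
        limsup_sets T (\<lambda>n. Ran (\<phi> n)) \<subseteq> V)"

end

theory Submission
  imports Defs
begin

text \<open>
  Let \<open>V\<close> be decomposed by \<open>\<phi>\<^sub>n\<close> and by idempotents \<open>\<theta>\<^sub>n\<close> with ranges \<open>W\<^sub>n\<close>, and put
  \<open>\<rho>\<^sub>n = \<phi>\<^sub>n\<^sup>\<bottom>\<theta>\<^sub>n\<^sup>\<bottom>\<close>. In the identity \<open>x = \<phi>\<^sub>n x + \<theta>\<^sub>n \<phi>\<^sub>n\<^sup>\<bottom> x + \<rho>\<^sub>n x\<close> the second term lies in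
  \<open>W\<^sub>n \<subseteq> V\<close>. The first terms are bounded, so by the Banach--Alaoglu theorem they have a cluster point,
  which lies in \<open>V\<close> by the condition on the upper limit. Hence \<open>x\<close> belongs to the closure of \<open>Y + V\<close> as soon as all
  \<open>\<rho>\<^sub>n x\<close> lie in \<open>Y\<close>. If \<open>x\<close> moreover lies in a closed invariant subspace \<open>S\<close>, so do all terms
  and the cluster point, and \<open>x\<close> belongs even to the closure of \<open>Y + S \<inter> V\<close>. This is
  \<open>in_closure_plus_inter_if_residuals\<close>; everything else follows from it by choosing \<open>Y\<close>, \<open>S\<close> and the reason
  for \<open>\<rho>\<^sub>n x \<in> Y\<close>.

  With \<open>Y = {0}\<close> it shows that \<open>V\<close> is itself invariant. On the closure of \<open>Y + V\<close> the hypothesis holds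
  because \<open>\<rho>\<^sub>n\<close> annihilates \<open>V\<close>; this gives \<open>modular_law\<close>. The
  distributive law is an induction on the number of the subspaces \<open>V\<^sub>j\<close>, in which the modular law
  splits off one of them while \<open>S\<close> collects the constraints from the others.

  On the reflexive hull of the closure of \<open>Y + V\<close>, the hypothesis \<open>\<rho>\<^sub>n x \<in> Y\<close> holds because \<open>Y\<close> is reflexive, so
  this closure is reflexive. By the distributive law, the closure of \<open>Y + \<Inter>\<^sub>j V\<^sub>j\<close> is an intersection of
  such reflexive subspaces.
\<close>

section \<open>The weak* topology\<close>

context dual_banach_space
begin

abbreviation wstar :: "'x topology" where
  "wstar \<equiv> weak_star pairing"

lemma topspace_wstar [simp]: "topspace wstar = UNIV"
  by (simp add: weak_star_def topspace_pullback_topology)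

lemma pairing_diff_left: "pairing (x - y) p = pairing x p - pairing y p"
  using pairing_add_left[of "x - y" y p] by simp

lemma norm_pairing_le: "norm (pairing x p) \<le> norm x * norm p"
  using onorm[OF pairing_bounded_linear, of x p] by (simp add: pairing_isometric)

lemma continuous_map_into_wstar:
  assumes "\<And>p. continuous_map S euclidean (\<lambda>s. pairing (f s) p)"
  shows "continuous_map S wstar f"
proof -
  have "continuous_map S (product_topology (\<lambda>_. euclidean) UNIV) (\<lambda>s. pairing (f s))"
    using assms by (simp add: continuous_map_componentwise_UNIV)
  then show ?thesis
    unfolding weak_star_def
    by (intro continuous_map_pullback') (simp_all add: euclidean_product_topology o_def)
qed

lemma continuous_map_wstar_pairing: "continuous_map wstar euclidean (\<lambda>x. pairing x p)"
proof -
  have "continuous_map wstar (product_topology (\<lambda>_. euclidean) UNIV) pairing"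
    using continuous_map_pullback[of euclidean euclidean "\<lambda>f. f" UNIV pairing]
    by (simp add: weak_star_def euclidean_product_topology o_def)
  then show ?thesis
    by (simp add: continuous_map_componentwise_UNIV)
qed

lemma closedin_wstar_singleton_0: "closedin wstar {0}"
proof -
  have "closedin wstar {x \<in> topspace wstar. pairing x p \<in> {0}}" for p
    by (rule closedin_continuous_map_preimage[OF continuous_map_wstar_pairing]) simp
  then have "closedin wstar (\<Inter>p. {x. pairing x p = 0})"
    by (intro closedin_INT) auto
  moreover have "x = 0" if "\<And>p. pairing x p = 0" for x
  proof -
    have "pairing x = (\<lambda>p. 0)"
      using that by blast
    then have "norm x = 0"
      using pairing_isometric[of x] by (simp add: onorm_zero)
    then show ?thesis
      by simp
  qed
  moreover have "pairing 0 p = 0" for p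
    using norm_pairing_le[of 0 p] by simp
  ultimately have "closedin wstar (\<Inter>p. {x. pairing x p = 0})" "(\<Inter>p. {x. pairing x p = 0}) = {0}"
    by auto
  then show ?thesis
    by simp
qed

lemma continuous_map_wstar_translation: "continuous_map wstar wstar (\<lambda>x. x + a)"
  by (intro continuous_map_into_wstar)
    (auto simp: pairing_add_left intro!: continuous_intros continuous_map_wstar_pairing)

lemma continuous_map_wstar_diff: "continuous_map wstar wstar (\<lambda>x. a - x)"
  by (intro continuous_map_into_wstar)
    (auto simp: pairing_diff_left intro!: continuous_intros continuous_map_wstar_pairing)

lemma continuous_map_wstar_scale: "continuous_map wstar wstar (scaleX c)"
proof (rule continuous_map_into_wstar)
  fix p
  have "continuous_map euclidean euclidean (\<lambda>z::'k. c * z)"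
    by (auto intro!: continuous_intros)
  from continuous_map_compose[OF continuous_map_wstar_pairing this]
  show "continuous_map wstar euclidean (\<lambda>x. pairing (scaleX c x) p)"
    by (simp add: pairing_scale_left o_def)
qed

lemma wstar_closure_mono_image:
  assumes "continuous_map wstar wstar f" "f ` S \<subseteq> wstar closure_of R"
  shows "f ` (wstar closure_of S) \<subseteq> wstar closure_of R"
proof -
  have "f ` (wstar closure_of S) \<subseteq> wstar closure_of (f ` S)"
    by (rule continuous_map_image_closure_subset[OF assms(1)])
  also have "\<dots> \<subseteq> wstar closure_of R"
    by (rule closure_of_minimal[OF assms(2) closedin_closure_of])
  finally show ?thesis .
qed

lemma subspace_wstar_closure:
  assumes S: "X.subspace S"
  shows "X.subspace (wstar closure_of S)"
proof (rule X.subspaceI)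
  have sub: "S \<subseteq> wstar closure_of S"
    by (simp add: closure_of_subset)
  show "0 \<in> wstar closure_of S"
    using X.subspace_0[OF S] sub by blast
  show "scaleX c x \<in> wstar closure_of S" if "x \<in> wstar closure_of S" for c x
    using wstar_closure_mono_image[OF continuous_map_wstar_scale, of c S S]
      X.subspace_scale[OF S] sub that by blast
  show "x + y \<in> wstar closure_of S" if xy: "x \<in> wstar closure_of S" "y \<in> wstar closure_of S" for x y
  proof -
    \<comment> \<open>Translation by an element of \<open>S\<close> preserves the closure; hence translation by an element of
      the closure maps \<open>S\<close>, and by continuity its closure, into the closure.\<close>
    have "x + s \<in> wstar closure_of S" if "s \<in> S" for s
      using wstar_closure_mono_image[OF continuous_map_wstar_translation, of s S S]
        X.subspace_add[OF S] sub that xy(1) by blast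
    then have "s + x \<in> wstar closure_of S" if "s \<in> S" for s
      using that by (simp add: add.commute)
    then have "y + x \<in> wstar closure_of S"
      using wstar_closure_mono_image[OF continuous_map_wstar_translation, of x S S] xy(2) by blast
    then show ?thesis
      by (simp add: add.commute)
  qed
qed

lemma subspace_set_plus:
  assumes "X.subspace S" "X.subspace R"
  shows "X.subspace (S + R)"
proof -
  have "S + R = {x + y |x y. x \<in> S \<and> y \<in> R}"
    by (auto simp: set_plus_def)
  then show ?thesis
    using X.subspace_sums[OF assms] by simp
qed

lemma cluster_point_in_closedin:
  assumes "cluster_point wstar u x" "closedin wstar S" "\<And>n. u n \<in> S"
  shows "x \<in> S"
proof (rule ccontr)
  assume "x \<notin> S"
  then have "\<exists>\<^sub>F n in sequentially. u n \<in> - S"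
    using assms(1,2) by (auto simp: cluster_point_def closedin_def Compl_eq_Diff_UNIV)
  then show False
    using assms(3) by (auto dest: frequently_ex)
qed

text \<open>
  This is the Banach--Alaoglu theorem for sequences. Through the pairing, a ball embeds into a
  product of closed balls of scalars, which is compact by Tychonoff's theorem. A pointwise cluster
  point there is again linear and bounded, and so it is the pairing with an element of the dual.
\<close>

lemma bounded_sequence_has_cluster_point:
  assumes bound: "\<And>n. norm (u n) \<le> r"
  obtains x where "cluster_point wstar u x"
proof -
  define L where "L = {f. (\<forall>p q. f (p + q) = f p + f q) \<and> (\<forall>c p. f (scaleP c p) = c * f p)}"
  define K where "K = (\<Pi>\<^sub>E p\<in>UNIV. cball (0::'k) (r * norm (p::'p)))"
  have coord: "continuous_on UNIV (\<lambda>f::'p \<Rightarrow> 'k. f p)" for p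
    by (rule continuous_on_product_coordinates)
  have "closed L"
    unfolding L_def
    by (intro closed_Collect_conj closed_Collect_all closed_Collect_eq continuous_intros coord)
  moreover have "compact K"
  proof -
    have "compactin (product_topology (\<lambda>_. euclidean) UNIV) K"
      unfolding K_def by (simp add: compactin_PiE)
    then show ?thesis
      by (simp add: euclidean_product_topology)
  qed
  ultimately have "compact (K \<inter> L)"
    by blast
  moreover have "pairing (u n) \<in> K \<inter> L" for n
  proof -
    have "norm (pairing (u n) p) \<le> r * norm p" for p
      using norm_pairing_le[of "u n" p] mult_right_mono[OF bound[of n] norm_ge_zero[of p]]
      by linarith
    moreover have "pairing (u n) (p + q) = pairing (u n) p + pairing (u n) q" for p q
      by (rule linear_add[OF bounded_linear.linear[OF pairing_bounded_linear]])
    ultimately show ?thesis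
      by (simp add: K_def L_def pairing_scale_right PiE_def Pi_def)
  qed
  ultimately obtain f where f: "f \<in> K \<inter> L"
    and cluster: "inf (nhds f) (filtermap (\<lambda>n. pairing (u n)) sequentially) \<noteq> bot"
    unfolding compact_filter
    by (metis (no_types, lifting) eventually_filtermap eventually_sequentiallyI
        filtermap_bot_iff sequentially_bot)
  have "bounded_linear f"
  proof (rule bounded_linear_intro)
    show "f (p + q) = f p + f q" for p q
      using f by (simp add: L_def)
    show "f (t *\<^sub>R p) = t *\<^sub>R f p" for t p
      using f by (simp add: L_def P.scale_of_real[symmetric] scaleR_conv_of_real)
    show "norm (f p) \<le> norm p * r" for p
      using f by (auto simp: K_def PiE_def Pi_def mult.commute)
  qed
  then obtain x where x: "pairing x = f"
    using pairing_onto[of f] f by (auto simp: L_def)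
  have "cluster_point wstar u x"
    unfolding cluster_point_def
  proof (intro conjI allI impI)
    fix U assume "openin wstar U \<and> x \<in> U"
    then obtain G where G: "open G" "U = pairing -` G" "f \<in> G"
      by (auto simp: weak_star_def openin_pullback_topology x)
    have "\<not> eventually (\<lambda>n. pairing (u n) \<notin> G) sequentially"
    proof
      assume "eventually (\<lambda>n. pairing (u n) \<notin> G) sequentially"
      then have "eventually (\<lambda>g. g \<notin> G) (filtermap (\<lambda>n. pairing (u n)) sequentially)"
        by (simp add: eventually_filtermap)
      moreover have "eventually (\<lambda>g. g \<in> G) (nhds f)"
        using G by (simp add: eventually_nhds_in_open)
      ultimately have "eventually (\<lambda>g. False)
          (inf (nhds f) (filtermap (\<lambda>n. pairing (u n)) sequentially))"
        unfolding eventually_inf by blast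
      then show False
        using cluster by (simp add: trivial_limit_def)
    qed
    then show "\<exists>\<^sub>F n in sequentially. u n \<in> U"
      by (simp add: G(2) frequently_def)
  qed simp
  then show thesis
    by (rule that)
qed

end

section \<open>Invariant subspaces and decompositions\<close>

locale dual_space_with_idempotents = dual_banach_space +
  fixes \<CC> :: "('b \<Rightarrow>\<^sub>L 'b) set"
  assumes algebra: "idempotent_boolean_algebra scaleX wstar \<CC>"
begin

lemma idem: "\<phi> \<in> \<CC> \<Longrightarrow> \<phi> (\<phi> x) = \<phi> x"
  using algebra by (metis idempotent_boolean_algebra_def blinfun_apply_blinfun_compose)

lemma commute: "\<phi> \<in> \<CC> \<Longrightarrow> \<psi> \<in> \<CC> \<Longrightarrow> \<phi> (\<psi> x) = \<psi> (\<phi> x)"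
  using algebra by (metis idempotent_boolean_algebra_def blinfun_apply_blinfun_compose)

lemma continuous: "\<phi> \<in> \<CC> \<Longrightarrow> continuous_map wstar wstar (blinfun_apply \<phi>)"
  using algebra by (simp add: idempotent_boolean_algebra_def)

lemma perp_mem: "\<phi> \<in> \<CC> \<Longrightarrow> id_blinfun - \<phi> \<in> \<CC>"
  using algebra by (simp add: idempotent_boolean_algebra_def)

lemma compose_mem: "\<phi> \<in> \<CC> \<Longrightarrow> \<psi> \<in> \<CC> \<Longrightarrow> \<phi> o\<^sub>L \<psi> \<in> \<CC>"
  using algebra by (simp add: idempotent_boolean_algebra_def)

lemma invariant_subspaceD:
  assumes "invariant_subspace scaleX \<CC> S"
  shows "X.subspace S" "\<phi> \<in> \<CC> \<Longrightarrow> x \<in> S \<Longrightarrow> \<phi> x \<in> S"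
  using assms by (auto simp: invariant_subspace_def)

lemma invariant_subspace_inter:
  assumes "invariant_subspace scaleX \<CC> S" "invariant_subspace scaleX \<CC> R"
  shows "invariant_subspace scaleX \<CC> (S \<inter> R)"
  unfolding invariant_subspace_def
  using X.subspace_inter invariant_subspaceD[OF assms(1)] invariant_subspaceD[OF assms(2)] by auto

lemma invariant_subspace_INT:
  assumes "\<And>i. i \<in> I \<Longrightarrow> invariant_subspace scaleX \<CC> (S i)"
  shows "invariant_subspace scaleX \<CC> (\<Inter>i\<in>I. S i)"
  unfolding invariant_subspace_def
proof (intro conjI ballI)
  show "X.subspace (\<Inter>i\<in>I. S i)"
    using assms by (intro X.subspace_Inter) (auto simp: invariant_subspace_def)
  show "blinfun_apply \<phi> ` (\<Inter>i\<in>I. S i) \<subseteq> (\<Inter>i\<in>I. S i)" if "\<phi> \<in> \<CC>" for \<phi>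
  proof (intro image_subsetI INT_I)
    fix x i assume "x \<in> (\<Inter>i\<in>I. S i)" and i: "i \<in> I"
    then have "x \<in> S i"
      by blast
    then show "\<phi> x \<in> S i"
      by (rule invariant_subspaceD(2)[OF assms[OF i] that])
  qed
qed

lemma invariant_subspace_closure_plus:
  assumes S: "invariant_subspace scaleX \<CC> S" and R: "invariant_subspace scaleX \<CC> R"
  shows "invariant_subspace scaleX \<CC> (wstar closure_of (S + R))"
  unfolding invariant_subspace_def
proof (intro conjI ballI)
  show "X.subspace (wstar closure_of (S + R))"
    by (intro subspace_wstar_closure subspace_set_plus invariant_subspaceD(1)[OF S]
        invariant_subspaceD(1)[OF R])
  fix \<phi> assume \<phi>: "\<phi> \<in> \<CC>"
  have "\<phi> (a + b) \<in> S + R" if "a \<in> S" "b \<in> R" for a b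
    using that by (simp add: blinfun.add_right set_plus_intro invariant_subspaceD(2)[OF S \<phi>]
        invariant_subspaceD(2)[OF R \<phi>])
  then have "blinfun_apply \<phi> ` (S + R) \<subseteq> S + R"
    by (auto elim!: set_plus_elim)
  also have "S + R \<subseteq> wstar closure_of (S + R)"
    by (simp add: closure_of_subset)
  finally show "blinfun_apply \<phi> ` (wstar closure_of (S + R)) \<subseteq> wstar closure_of (S + R)"
    by (rule wstar_closure_mono_image[OF continuous[OF \<phi>]])
qed

text \<open>
  The residual idempotent \<open>\<phi>\<^sup>\<bottom>\<theta>\<^sup>\<bottom>\<close> is the complement of the join of \<open>\<phi>\<close> and \<open>\<theta>\<close>.
  It annihilates exactly \<open>Ran \<phi> + Ran \<theta>\<close>.
\<close>

definition residual :: "('b \<Rightarrow>\<^sub>L 'b) \<Rightarrow> ('b \<Rightarrow>\<^sub>L 'b) \<Rightarrow> 'b \<Rightarrow>\<^sub>L 'b" where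
  "residual \<phi> \<theta> = (id_blinfun - \<phi>) o\<^sub>L (id_blinfun - \<theta>)"

lemma residual_mem: "\<phi> \<in> \<CC> \<Longrightarrow> \<theta> \<in> \<CC> \<Longrightarrow> residual \<phi> \<theta> \<in> \<CC>"
  by (simp add: residual_def compose_mem perp_mem)

lemma residual_apply: "residual \<phi> \<theta> x = x - \<theta> x - \<phi> (x - \<theta> x)"
  by (simp add: residual_def blinfun.diff_left)

text \<open>
  The injective subspaces are represented by idempotents \<open>\<theta> n\<close> onto them, so that the inclusion of \<open>V\<close> in
  a sum of two ranges becomes an equation.
\<close>

definition decomposes :: "(nat \<Rightarrow> 'b \<Rightarrow>\<^sub>L 'b) \<Rightarrow> (nat \<Rightarrow> 'b \<Rightarrow>\<^sub>L 'b) \<Rightarrow> 'b set \<Rightarrow> bool" where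
  "decomposes \<phi> \<theta> V \<longleftrightarrow>
     (\<forall>n. \<phi> n \<in> \<CC> \<and> \<theta> n \<in> \<CC> \<and> Ran (\<theta> n) \<subseteq> V) \<and>
     (\<exists>C. \<forall>n. norm (\<phi> n) \<le> C) \<and>
     (\<forall>n. \<forall>v\<in>V. residual (\<phi> n) (\<theta> n) v = 0) \<and>
     limsup_sets wstar (\<lambda>n. Ran (\<phi> n)) \<subseteq> V"

lemma decomposable_subspaceE:
  assumes "decomposable_subspace scaleX wstar \<CC> V"
  obtains \<phi> \<theta> where "X.subspace V" "closedin wstar V" "decomposes \<phi> \<theta> V"
proof -
  from assms obtain \<phi> W C where V: "X.subspace V" "closedin wstar V"
    and \<phi>: "\<And>n. \<phi> n \<in> \<CC>" and W: "\<And>n::nat. injective_subspace scaleX \<CC> (W n)"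
    and C: "\<And>n. norm (\<phi> n) \<le> C" and sub: "\<And>n. V \<subseteq> Ran (\<phi> n) + W n"
    and WV: "\<And>n. W n \<subseteq> V" and lim: "limsup_sets wstar (\<lambda>n. Ran (\<phi> n)) \<subseteq> V"
    unfolding decomposable_subspace_def by blast
  from W obtain \<theta> where \<theta>: "\<And>n. \<theta> n \<in> \<CC>" "\<And>n. W n = Ran (\<theta> n)"
    unfolding injective_subspace_def by metis
  have "residual (\<phi> n) (\<theta> n) v = 0" if v: "v \<in> V" for n v
  proof -
    obtain a b where v: "v = \<phi> n a + \<theta> n b"
      using sub[of n] v by (auto simp: \<theta>(2) set_plus_def)
    show ?thesis
      by (simp add: v residual_apply blinfun.add_right blinfun.diff_right idem[OF \<theta>(1)]
          idem[OF \<phi>] commute[OF \<theta>(1) \<phi>])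
  qed
  then have "decomposes \<phi> \<theta> V"
    using \<phi> \<theta> WV C lim unfolding decomposes_def by auto
  with V show thesis
    by (rule that)
qed

text \<open>
  This carries the whole proof. Since \<open>\<phi>\<^sup>\<bottom> = \<phi>\<^sup>\<bottom>\<theta>\<^sup>\<bottom> + \<theta>\<phi>\<^sup>\<bottom>\<close>, the hypothesis on
  residuals makes each \<open>x - \<phi>\<^sub>n x\<close> an element of \<open>Y + S \<inter> V\<close>. The vectors \<open>\<phi>\<^sub>n x\<close> stay in \<open>S\<close> and are
  bounded, unlike possibly the \<open>\<theta>\<^sub>n x\<close>, so they have a cluster point, and it lies in \<open>S \<inter> V\<close>.
\<close>

lemma in_closure_plus_inter_if_residuals:
  assumes Y: "invariant_subspace scaleX \<CC> Y"
    and S: "invariant_subspace scaleX \<CC> S" "closedin wstar S"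
    and V: "X.subspace V" "decomposes \<phi> \<theta> V"
    and x: "x \<in> S" "\<And>n. residual (\<phi> n) (\<theta> n) x \<in> Y"
  shows "x \<in> wstar closure_of (Y + S \<inter> V)"
proof -
  let ?K = "wstar closure_of (Y + S \<inter> V)"
  obtain C where \<phi>: "\<And>n. \<phi> n \<in> \<CC>" and \<theta>: "\<And>n. \<theta> n \<in> \<CC>" "\<And>n. Ran (\<theta> n) \<subseteq> V"
    and C: "\<And>n. norm (\<phi> n) \<le> C" and lim: "limsup_sets wstar (\<lambda>n. Ran (\<phi> n)) \<subseteq> V"
    using V(2) unfolding decomposes_def by blast
  have SV: "X.subspace (S \<inter> V)"
    by (intro X.subspace_inter V(1) invariant_subspaceD(1)[OF S(1)])
  have sub: "Y + S \<inter> V \<subseteq> ?K"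
    by (simp add: closure_of_subset)
  have K: "X.subspace ?K"
    by (intro subspace_wstar_closure subspace_set_plus SV invariant_subspaceD(1)[OF Y])
  have "norm (\<phi> n x) \<le> C * norm x" for n
    using norm_blinfun[of "\<phi> n" x] mult_right_mono[OF C[of n] norm_ge_zero[of x]] by linarith
  then obtain v where v: "cluster_point wstar (\<lambda>n. \<phi> n x) v"
    by (rule bounded_sequence_has_cluster_point)
  then have "v \<in> limsup_sets wstar (\<lambda>n. Ran (\<phi> n))"
    unfolding limsup_sets_def by (intro CollectI exI[of _ "\<lambda>n. \<phi> n x"]) simp
  with lim have "v \<in> V"
    by blast
  moreover have "v \<in> S"
    using cluster_point_in_closedin[OF v S(2)] invariant_subspaceD(2)[OF S(1) \<phi> x(1)] by blast
  ultimately have "0 + v \<in> Y + S \<inter> V"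
    by (intro set_plus_intro X.subspace_0[OF invariant_subspaceD(1)[OF Y]]) simp
  with sub have vK: "v \<in> ?K"
    by auto
  have "x - \<phi> n x \<in> ?K" for n
  proof -
    have "x - \<phi> n x = residual (\<phi> n) (\<theta> n) x + \<theta> n (x - \<phi> n x)"
      by (simp add: residual_apply blinfun.diff_right commute[OF \<theta>(1) \<phi>])
    moreover have "\<theta> n (x - \<phi> n x) \<in> S"
      by (intro invariant_subspaceD(2)[OF S(1)] \<theta>(1) \<phi> x(1)
          X.subspace_diff[OF invariant_subspaceD(1)[OF S(1)]])
    moreover have "\<theta> n (x - \<phi> n x) \<in> V"
      using \<theta>(2) by blast
    ultimately show ?thesis
      using x(2)[of n] sub by (auto simp: set_plus_def)
  qed
  moreover have "closedin wstar {u. x - u \<in> ?K}"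
    using closedin_continuous_map_preimage[OF continuous_map_wstar_diff closedin_closure_of, of x]
    by simp
  ultimately have "x - v \<in> ?K"
    using cluster_point_in_closedin[OF v, of "{u. x - u \<in> ?K}"] by blast
  then have "(x - v) + v \<in> ?K"
    by (rule X.subspace_add[OF K _ vK])
  then show ?thesis
    by simp
qed

lemma invariant_subspace_UNIV: "invariant_subspace scaleX \<CC> UNIV"
  by (simp add: invariant_subspace_def)

text \<open>
  The residuals of \<open>\<psi> v\<close> vanish together with those of \<open>v\<close>, so that the preceding lemma applies
  with the zero subspace in place of \<open>Y\<close>.
\<close>

lemma decomposable_imp_invariant:
  assumes "decomposable_subspace scaleX wstar \<CC> V"
  shows "invariant_subspace scaleX \<CC> V"
proof -
  obtain \<phi> \<theta> where V: "X.subspace V" "closedin wstar V" "decomposes \<phi> \<theta> V"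
    using assms by (rule decomposable_subspaceE)
  have "\<psi> v \<in> V" if \<psi>: "\<psi> \<in> \<CC>" and v: "v \<in> V" for \<psi> v
  proof -
    have "residual (\<phi> n) (\<theta> n) (\<psi> v) \<in> {0}" for n
      using V(3) v commute[OF residual_mem \<psi>] by (auto simp: decomposes_def)
    moreover have "invariant_subspace scaleX \<CC> {0}"
      by (auto simp: invariant_subspace_def)
    ultimately have "\<psi> v \<in> wstar closure_of ({0} + UNIV \<inter> V)"
      using V closedin_topspace[of wstar]
      by (intro in_closure_plus_inter_if_residuals invariant_subspace_UNIV) auto
    also have "{0} + UNIV \<inter> V = V"
      by (auto simp: set_plus_def)
    finally show ?thesis
      using V(2) by (simp add: closure_of_closedin)
  qed
  then show ?thesis
    using V(1) by (auto simp: invariant_subspace_def)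
qed

section \<open>The distributive law\<close>

text \<open>
  A residual annihilates \<open>V\<close> and preserves \<open>Y\<close>. It is weak* continuous and \<open>Y\<close> is closed, so it
  maps the closure of \<open>Y + V\<close> into \<open>Y\<close>.
\<close>

lemma modular_law:
  assumes Y: "invariant_subspace scaleX \<CC> Y" "closedin wstar Y"
    and S: "invariant_subspace scaleX \<CC> S" "closedin wstar S"
    and V: "decomposable_subspace scaleX wstar \<CC> V"
  shows "S \<inter> wstar closure_of (Y + V) \<subseteq> wstar closure_of (Y + S \<inter> V)"
proof
  fix x assume x: "x \<in> S \<inter> wstar closure_of (Y + V)"
  obtain \<phi> \<theta> where V': "X.subspace V" "decomposes \<phi> \<theta> V"
    using V by (rule decomposable_subspaceE)
  have "residual (\<phi> n) (\<theta> n) x \<in> Y" for n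
  proof -
    have res: "residual (\<phi> n) (\<theta> n) \<in> \<CC>" "\<forall>v\<in>V. residual (\<phi> n) (\<theta> n) v = 0"
      using V'(2) by (auto simp: decomposes_def residual_mem)
    have "residual (\<phi> n) (\<theta> n) (y + v) \<in> Y" if "y \<in> Y" "v \<in> V" for y v
      using res that invariant_subspaceD(2)[OF Y(1)] by (simp add: blinfun.add_right)
    then have "blinfun_apply (residual (\<phi> n) (\<theta> n)) ` (Y + V) \<subseteq> wstar closure_of Y"
      using Y(2) by (auto simp: set_plus_def closure_of_closedin)
    from wstar_closure_mono_image[OF continuous[OF res(1)] this] show ?thesis
      using x Y(2) by (auto simp: closure_of_closedin)
  qed
  with x V' show "x \<in> wstar closure_of (Y + S \<inter> V)"
    by (intro in_closure_plus_inter_if_residuals Y(1) S) auto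
qed

text \<open>
  The closed invariant subspace \<open>S\<close> makes the induction go through: to split off \<open>V j\<close>, the modular law is
  applied to the intersection of \<open>S\<close> with the closures of \<open>Y + V i\<close> for the other indices \<open>i\<close>. The
  induction hypothesis is then applied to \<open>S \<inter> V j\<close> in place of \<open>S\<close>.
\<close>

lemma inter_closures_subset:
  assumes Y: "invariant_subspace scaleX \<CC> Y" "closedin wstar Y"
    and "finite J"
    and "\<And>j. j \<in> J \<Longrightarrow> decomposable_subspace scaleX wstar \<CC> (V j)"
    and "invariant_subspace scaleX \<CC> S" "closedin wstar S"
  shows "S \<inter> (\<Inter>j\<in>J. wstar closure_of (Y + V j)) \<subseteq> wstar closure_of (Y + S \<inter> (\<Inter>j\<in>J. V j))"
  using assms(3-)
proof (induction J arbitrary: S rule: finite_induct)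
  case empty
  have "S \<subseteq> Y + S"
    using X.subspace_0[OF invariant_subspaceD(1)[OF Y(1)]] by (force simp: set_plus_def)
  also have "\<dots> \<subseteq> wstar closure_of (Y + S)"
    by (simp add: closure_of_subset)
  finally show ?case
    by simp
next
  case (insert j J)
  let ?H = "S \<inter> (\<Inter>i\<in>J. wstar closure_of (Y + V i))"
  let ?I = "S \<inter> (\<Inter>i\<in>insert j J. V i)"
  have dec: "decomposable_subspace scaleX wstar \<CC> (V j)"
    using insert.prems by blast
  then have Vj: "invariant_subspace scaleX \<CC> (V j)" "closedin wstar (V j)"
    by (auto simp: decomposable_imp_invariant decomposable_subspace_def)
  have inv: "invariant_subspace scaleX \<CC> (wstar closure_of (Y + V i))" if "i \<in> J" for i
    using that insert.prems by (intro invariant_subspace_closure_plus Y decomposable_imp_invariant) auto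
  have H: "invariant_subspace scaleX \<CC> ?H" "closedin wstar ?H"
  proof -
    show "invariant_subspace scaleX \<CC> ?H"
      by (intro invariant_subspace_inter insert.prems(2) invariant_subspace_INT inv)
    show "closedin wstar ?H"
      using closedin_INT[of J wstar "\<lambda>i. wstar closure_of (Y + V i)"] insert.prems(3)
      by (cases "J = {}") (auto intro: closedin_Int)
  qed
  have Vinv: "invariant_subspace scaleX \<CC> (V i)" if "i \<in> insert j J" for i
    using that insert.prems(1) by (blast intro: decomposable_imp_invariant)
  have VI: "X.subspace (\<Inter>i\<in>insert j J. V i)"
    by (intro invariant_subspaceD(1) invariant_subspace_INT Vinv)
  then have YI: "X.subspace (wstar closure_of (Y + ?I))"
    by (intro subspace_wstar_closure subspace_set_plus invariant_subspaceD(1)[OF Y(1)]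
        X.subspace_inter invariant_subspaceD(1)[OF insert.prems(2)])
  have "S \<inter> V j \<inter> (\<Inter>i\<in>J. wstar closure_of (Y + V i))
      \<subseteq> wstar closure_of (Y + S \<inter> V j \<inter> (\<Inter>i\<in>J. V i))"
    using insert.prems Vj
    by (intro insert.IH invariant_subspace_inter closedin_Int) auto
  then have IH: "?H \<inter> V j \<subseteq> wstar closure_of (Y + ?I)"
    by (simp add: Int_ac)
  have "Y \<subseteq> Y + ?I"
    using X.subspace_0[OF invariant_subspaceD(1)[OF insert.prems(2)]]
      X.subspace_0[OF VI]
    by (force simp: set_plus_def)
  then have "Y \<subseteq> wstar closure_of (Y + ?I)"
    using closure_of_subset[of "Y + ?I" wstar] by simp
  with IH have "Y + ?H \<inter> V j \<subseteq> wstar closure_of (Y + ?I)"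
    using X.subspace_add[OF YI] by (auto simp: set_plus_def)
  then have "wstar closure_of (Y + ?H \<inter> V j) \<subseteq> wstar closure_of (Y + ?I)"
    by (rule closure_of_minimal) simp
  with modular_law[OF Y H dec] show ?case
    by auto
qed

lemma closure_plus_INT:
  assumes Y: "invariant_subspace scaleX \<CC> Y" "closedin wstar Y" and "finite J"
    and "\<And>j. j \<in> J \<Longrightarrow> decomposable_subspace scaleX wstar \<CC> (V j)"
  shows "wstar closure_of (Y + (\<Inter>j\<in>J. V j)) = (\<Inter>j\<in>J. wstar closure_of (Y + V j))"
proof
  show "wstar closure_of (Y + (\<Inter>j\<in>J. V j)) \<subseteq> (\<Inter>j\<in>J. wstar closure_of (Y + V j))"
    by (intro INT_greatest closure_of_mono set_plus_mono2) auto
  show "(\<Inter>j\<in>J. wstar closure_of (Y + V j)) \<subseteq> wstar closure_of (Y + (\<Inter>j\<in>J. V j))"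
    using inter_closures_subset[OF assms invariant_subspace_UNIV] closedin_topspace[of wstar] by simp
qed

section \<open>Reflexivity\<close>

lemma reflexive_hull_mono:
  assumes "S \<subseteq> R" "0 \<in> S"
  shows "reflexive_hull \<CC> S \<subseteq> reflexive_hull \<CC> R"
proof
  fix x assume x: "x \<in> reflexive_hull \<CC> S"
  have "\<phi> x = 0" if "\<phi> \<in> \<CC>" "blinfun_apply \<phi> ` R = {0}" for \<phi>
  proof -
    have "\<phi> s = 0" if "s \<in> S" for s
      using assms(1) \<open>blinfun_apply \<phi> ` R = {0}\<close> that by blast
    then have "blinfun_apply \<phi> ` S = {0}"
      using assms(2) by auto
    then show ?thesis
      using x that(1) by (simp add: reflexive_hull_def)
  qed
  then show "x \<in> reflexive_hull \<CC> R"
    by (simp add: reflexive_hull_def)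
qed

lemma subset_reflexive_hull: "S \<subseteq> reflexive_hull \<CC> S"
  by (auto simp: reflexive_hull_def)

text \<open>
  If \<open>\<psi>\<close> annihilates \<open>Y\<close>, then \<open>\<psi>\<close> composed with a residual annihilates \<open>Y + V\<close>. Hence the residuals of
  a point in the reflexive hull lie in the reflexive hull of \<open>Y\<close>, which is \<open>Y\<close>.
\<close>

lemma reflexive_hull_closure_plus:
  assumes Y: "invariant_subspace scaleX \<CC> Y" "reflexive_subspace scaleX \<CC> Y"
    and V: "decomposable_subspace scaleX wstar \<CC> V"
  shows "reflexive_hull \<CC> (wstar closure_of (Y + V)) \<subseteq> wstar closure_of (Y + V)"
proof
  fix x assume x: "x \<in> reflexive_hull \<CC> (wstar closure_of (Y + V))"
  obtain \<phi> \<theta> where V': "X.subspace V" "decomposes \<phi> \<theta> V"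
    using V by (rule decomposable_subspaceE)
  have YV0: "0 \<in> wstar closure_of (Y + V)"
    by (intro X.subspace_0 subspace_wstar_closure subspace_set_plus V'(1)
        invariant_subspaceD(1)[OF Y(1)])
  have "residual (\<phi> n) (\<theta> n) x \<in> Y" for n
  proof -
    let ?\<rho> = "residual (\<phi> n) (\<theta> n)"
    have res: "?\<rho> \<in> \<CC>" "\<forall>v\<in>V. ?\<rho> v = 0"
      using V'(2) by (auto simp: decomposes_def residual_mem)
    have "\<psi> (?\<rho> x) = 0" if \<psi>: "\<psi> \<in> \<CC>" "blinfun_apply \<psi> ` Y = {0}" for \<psi>
    proof -
      have "\<psi> (?\<rho> (y + v)) = 0" if "y \<in> Y" "v \<in> V" for y v
        using res that \<psi> invariant_subspaceD(2)[OF Y(1)] by (auto simp: blinfun.add_right)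
      then have "blinfun_apply (\<psi> o\<^sub>L ?\<rho>) ` (Y + V) \<subseteq> wstar closure_of {0}"
        using closedin_wstar_singleton_0 by (auto simp: set_plus_def closure_of_closedin)
      from wstar_closure_mono_image[OF continuous[OF compose_mem[OF \<psi>(1) res(1)]] this]
      have "blinfun_apply (\<psi> o\<^sub>L ?\<rho>) ` (wstar closure_of (Y + V)) = {0}"
        using closedin_wstar_singleton_0 YV0 by (auto simp: closure_of_closedin image_iff intro!: bexI[of _ 0])
      then have "(\<psi> o\<^sub>L ?\<rho>) x = 0"
        using x compose_mem[OF \<psi>(1) res(1)] by (simp only: reflexive_hull_def mem_Collect_eq)
      then show ?thesis
        by simp
    qed
    then have "?\<rho> x \<in> reflexive_hull \<CC> Y"
      by (simp add: reflexive_hull_def)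
    then show ?thesis
      using Y(2) by (simp add: reflexive_subspace_def)
  qed
  then have "x \<in> wstar closure_of (Y + UNIV \<inter> V)"
    using V' closedin_topspace[of wstar]
    by (intro in_closure_plus_inter_if_residuals Y(1) invariant_subspace_UNIV) auto
  then show "x \<in> wstar closure_of (Y + V)"
    by simp
qed

text \<open>
  The distributive law writes the closure as an intersection of reflexive subspaces, and the
  reflexive hull is monotone.
\<close>

lemma reflexive_closure_plus_INT:
  assumes Y: "invariant_subspace scaleX \<CC> Y" "closedin wstar Y" "reflexive_subspace scaleX \<CC> Y"
    and J: "finite J"
    and V: "\<And>j. j \<in> J \<Longrightarrow> decomposable_subspace scaleX wstar \<CC> (V j)"
  shows "reflexive_subspace scaleX \<CC> (wstar closure_of (Y + (\<Inter>j\<in>J. V j)))"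
proof -
  let ?K = "wstar closure_of (Y + (\<Inter>j\<in>J. V j))"
  have K: "?K = (\<Inter>j\<in>J. wstar closure_of (Y + V j))"
    using closure_plus_INT[OF Y(1,2) J V] .
  have subsp: "X.subspace ?K"
    using V by (intro subspace_wstar_closure subspace_set_plus invariant_subspaceD(1)[OF Y(1)]
        X.subspace_Inter) (auto simp: decomposable_subspace_def)
  have "reflexive_hull \<CC> ?K \<subseteq> wstar closure_of (Y + V j)" if "j \<in> J" for j
  proof -
    have "?K \<subseteq> wstar closure_of (Y + V j)"
      using K that by blast
    then show ?thesis
      using reflexive_hull_mono[OF _ X.subspace_0[OF subsp]]
        reflexive_hull_closure_plus[OF Y(1,3) V[OF that]] by blast
  qed
  then have "reflexive_hull \<CC> ?K \<subseteq> ?K"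
    using K by blast
  with subsp show ?thesis
    unfolding reflexive_subspace_def using subset_reflexive_hull by blast
qed

end

theorem theorem2p10:
  fixes scaleX :: "'k::{real_normed_field, heine_borel} \<Rightarrow> 'x::banach \<Rightarrow> 'x"
    and scaleP :: "'k \<Rightarrow> 'p::banach \<Rightarrow> 'p"
    and pairing :: "'x \<Rightarrow> 'p \<Rightarrow> 'k"
    and \<CC> :: "('x \<Rightarrow>\<^sub>L 'x) set"
    and Y :: "'x set"
    and V :: "nat \<Rightarrow> 'x set"
    and k :: nat
  assumes "dual_banach_space scaleX scaleP pairing"
    and "idempotent_boolean_algebra scaleX (weak_star pairing) \<CC>"
    and "closedin (weak_star pairing) Y"
    and "invariant_subspace scaleX \<CC> Y"
    and "k \<ge> 1"
    and "\<And>j. j \<in> {1..k} \<Longrightarrow> decomposable_subspace scaleX (weak_star pairing) \<CC> (V j)"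
  shows "weak_star pairing closure_of (Y + (\<Inter>j\<in>{1..k}. V j)) =
           (\<Inter>j\<in>{1..k}. weak_star pairing closure_of (Y + V j)) \<and>
         (reflexive_subspace scaleX \<CC> Y \<longrightarrow>
           reflexive_subspace scaleX \<CC> (weak_star pairing closure_of (Y + (\<Inter>j\<in>{1..k}. V j))))"
proof -
  interpret dual_space_with_idempotents scaleX scaleP pairing \<CC>
    using assms(1,2)
    by (simp add: dual_space_with_idempotents_def dual_space_with_idempotents_axioms_def)
  show ?thesis
    using closure_plus_INT[of Y "{1..k}" V] reflexive_closure_plus_INT[of Y "{1..k}" V] assms(3,4,6)
    by blast
qed

end
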